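(* Assume $m<n-1$. Let $y^0,y^1\in\mathcal{C}^{\mathrm{o}}$, put $h_k=P_Hy^k$ for $k=0,1$, and suppose $h_0\ne h_1$. Let $H_\perp$ be the subspace of $H$ of co-dimension one in $H$ that is orthogonal to $h_1-h_0$, and define, for $h\in[h_0,h_1]$, $$\bar s(h,h_0,h_1)=\frac{\sup\{\langle F(x),h_1-h_0\rangle : x\in(h+H_\perp+H^\perp)\cap\mathcal{C}\}}{|h_1-h_0|}.$$ Then $$T_{\mathcal{C}}(y^0,y^1)\ \ge\ \int_{h\in[h_0,h_1]}\frac{dh}{\bar s(h,h_0,h_1)}$$ (whenever the integral on the right is well defined as an element of $[-\infty,+\infty]$).
   Context: Setting. Let $m<n$ be positive integers, $F:\mathbb{R}^n\to\mathbb{R}^n$ a Lipschitz vector field with Lipschitz constant $L_F>0$, $B$ a real $n\times m$ matrix of rank $m$, and $\mathcal{C}\subset\mathbb{R}^n$ a bounded convex set with nonempty interior $\mathcal{C}^{\mathrm{o}}$ and $C^1$ boundary. The control system is $$\dot y(t)=F(y(t))+Bu(t). \qquad ( * )$$ Solutions are absolutely continuous functions satisfying the equation for almost every $t$. Notation. $H=(\mathrm{ran}\,B)^\perp$ is the orthogonal complement of the range of $B$ in $\mathbb{R}^n$ (so $\dim H=n-m$) and $H^\perp=\mathrm{ran}\,B$. $P_H$ is the orthogonal projection onto $H$; $F_H(y):=P_HF(y)$. $[h_0,h_1]$ is the closed segment joining $h_0$ and $h_1$, and $\int_{h\in[h_0,h_1]}\cdot\,dh$ denotes integration with respect to arc length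 on it. Measurable selection assumption (a standing assumption of the setting). Let $\mathcal{D}_f$ be the set of $(h_1,h_2)\in H\times H$ such that for some $h^\perp\in H^\perp$ one has $h_1=F_H(h_2+h^\perp)$ and $h_2+h^\perp\in\mathcal{C}$. It is assumed that there is a Borel measurable map $f:\mathcal{D}_f\to H^\perp$ such that $h_1=F_H(h_2+f(h_1,h_2))$ and $h_2+f(h_1,h_2)\in\mathcal{C}$ for every $(h_1,h_2)\in\mathcal{D}_f$. Controllability time (with $\inf\varnothing=+\infty$). For $y^0,y^1\in\mathcal{C}^{\mathrm{o}}$, $T_{\mathcal{C}}(y^0,y^1)$ is the infimum of all $T>0$ for which there exist $u\in L^\infty([0,T],\mathbb{R}^m)$ and a solution $y$ of $( * )$ on $[0,T]$ with $y(0)=y^0$, $y(T)=y^1$ and $y(t)\in\mathcal{C}$ for all $t\in[0,T]$. *)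

theory Defs
  imports "HOL-Analysis.Analysis"
begin

subsection \<open>The control system\<close>

definition abs_continuous_on :: "real \<Rightarrow> real \<Rightarrow> (real \<Rightarrow> 'a::real_normed_vector) \<Rightarrow> bool"
  where "abs_continuous_on a b y \<longleftrightarrow>
    (\<forall>\<epsilon>>0. \<exists>\<delta>>0. \<forall>(I :: nat set) l r.
       finite I \<longrightarrow>
       (\<forall>i\<in>I. a \<le> l i \<and> l i \<le> r i \<and> r i \<le> b) \<longrightarrow>
       disjoint_family_on (\<lambda>i. {l i<..<r i}) I \<longrightarrow>
       (\<Sum>i\<in>I. r i - l i) < \<delta> \<longrightarrow>
       (\<Sum>i\<in>I. norm (y (r i) - y (l i))) < \<epsilon>)"

text \<open>Representatives of elements of \<open>L\<^sup>\<infinity>([0,T])\<close>.\<close>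

definition L_infty_on :: "real \<Rightarrow> (real \<Rightarrow> real^'m) \<Rightarrow> bool"
  where "L_infty_on T u \<longleftrightarrow>
    u \<in> borel_measurable (lebesgue_on {0..T}) \<and>
    (\<exists>K. AE t in lebesgue_on {0..T}. norm (u t) \<le> K)"

definition control_solution ::
    "(real^'n \<Rightarrow> real^'n) \<Rightarrow> real^'m^'n \<Rightarrow> real \<Rightarrow> (real \<Rightarrow> real^'m) \<Rightarrow> (real \<Rightarrow> real^'n) \<Rightarrow> bool"
  where "control_solution F B T u y \<longleftrightarrow>
    abs_continuous_on 0 T y \<and>
    (AE t in lebesgue_on {0..T}.
       (y has_vector_derivative (F (y t) + B *v u t)) (at t within {0..T}))"

text \<open>The infimum is taken in the extended reals, where \<open>Inf {} = \<infinity>\<close>.\<close>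

definition control_time ::
    "(real^'n \<Rightarrow> real^'n) \<Rightarrow> real^'m^'n \<Rightarrow> (real^'n) set \<Rightarrow> real^'n \<Rightarrow> real^'n \<Rightarrow> ereal"
  where "control_time F B C y0 y1 =
    Inf {ereal T | T. T > 0 \<and>
      (\<exists>u y. L_infty_on T u \<and> control_solution F B T u y \<and>
         y 0 = y0 \<and> y T = y1 \<and> (\<forall>t\<in>{0..T}. y t \<in> C))}"

subsection \<open>The constraint set\<close>

text \<open>
  The boundary of \<open>C\<close> is locally the zero set of a \<open>C\<^sup>1\<close> function \<open>\<psi>\<close> with non-vanishing
  gradient \<open>g\<close>, with the interior of \<open>C\<close> on one side of it.
\<close>

definition C1_boundary :: "('a::euclidean_space) set \<Rightarrow> bool"
  where "C1_boundary C \<longleftrightarrow>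
    (\<forall>p\<in>frontier C. \<exists>U (\<psi> :: 'a \<Rightarrow> real) g.
       open U \<and> p \<in> U \<and>
       (\<forall>x\<in>U. (\<psi> has_derivative (\<lambda>v. g x \<bullet> v)) (at x)) \<and>
       continuous_on U g \<and> (\<forall>x\<in>U. g x \<noteq> 0) \<and>
       frontier C \<inter> U = {x\<in>U. \<psi> x = 0} \<and>
       interior C \<inter> U = {x\<in>U. \<psi> x < 0})"

subsection \<open>Projection and measurable selection\<close>

definition matrix_ran :: "real^'m^'n \<Rightarrow> (real^'n) set"
  where "matrix_ran B = range ((*v) B)"

definition H_space :: "real^'m^'n \<Rightarrow> (real^'n) set"
  where "H_space B = orthogonal_comp (matrix_ran B)"

definition orth_proj :: "('a::euclidean_space) set \<Rightarrow> 'a \<Rightarrow> 'a"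
  where "orth_proj S y = (THE p. p \<in> S \<and> y - p \<in> orthogonal_comp S)"

lemma orth_proj_eqI:
  assumes "subspace S" "p \<in> S" "y - p \<in> orthogonal_comp S"
  shows "orth_proj S y = p"
  unfolding orth_proj_def
proof (rule the_equality)
  show "p \<in> S \<and> y - p \<in> orthogonal_comp S" using assms by blast
next
  fix q assume q: "q \<in> S \<and> y - q \<in> orthogonal_comp S"
  have "p - q \<in> S" using assms q by (simp add: subspace_diff)
  moreover have "p - q \<in> orthogonal_comp S"
    using subspace_diff[OF subspace_orthogonal_comp, of "y - q" S "y - p"] q assms by simp
  ultimately have "orthogonal (p - q) (p - q)" by (auto simp: orthogonal_comp_def)
  then show "q = p" by (simp add: orthogonal_self)
qed

lemma orth_proj_in:
  assumes "subspace S"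
  shows "orth_proj S y \<in> S" "y - orth_proj S y \<in> orthogonal_comp S"
proof -
  obtain p z where "p \<in> span S" "\<And>w. w \<in> span S \<Longrightarrow> orthogonal z w" "y = p + z"
    using orthogonal_subspace_decomp_exists by metis
  then have "p \<in> S" "y - p \<in> orthogonal_comp S"
    using assms by (auto simp: orthogonal_comp_def orthogonal_commute span_eq_iff[THEN iffD2])
  with orth_proj_eqI[OF assms this]
  show "orth_proj S y \<in> S" "y - orth_proj S y \<in> orthogonal_comp S" by auto
qed

definition F_H :: "(real^'n \<Rightarrow> real^'n) \<Rightarrow> real^'m^'n \<Rightarrow> real^'n \<Rightarrow> real^'n"
  where "F_H F B y = orth_proj (H_space B) (F y)"

definition selection_domain ::
    "(real^'n \<Rightarrow> real^'n) \<Rightarrow> real^'m^'n \<Rightarrow> (real^'n) set \<Rightarrow> ((real^'n) \<times> (real^'n)) set"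
  where "selection_domain F B C =
    {(h1, h2). h1 \<in> H_space B \<and> h2 \<in> H_space B \<and>
       (\<exists>p\<in>matrix_ran B. h1 = F_H F B (h2 + p) \<and> h2 + p \<in> C)}"

definition measurable_selection ::
    "(real^'n \<Rightarrow> real^'n) \<Rightarrow> real^'m^'n \<Rightarrow> (real^'n) set \<Rightarrow> bool"
  where "measurable_selection F B C \<longleftrightarrow>
    (\<exists>f. f \<in> borel_measurable (restrict_space borel (selection_domain F B C)) \<and>
       (\<forall>(h1, h2)\<in>selection_domain F B C.
          f (h1, h2) \<in> matrix_ran B \<and>
          h1 = F_H F B (h2 + f (h1, h2)) \<and> h2 + f (h1, h2) \<in> C))"

subsection \<open>The lower bound\<close>

definition H_perp :: "real^'m^'n \<Rightarrow> real^'n \<Rightarrow> real^'n \<Rightarrow> (real^'n) set"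
  where "H_perp B h0 h1 = {v \<in> H_space B. orthogonal v (h1 - h0)}"

definition s_bar ::
    "(real^'n \<Rightarrow> real^'n) \<Rightarrow> real^'m^'n \<Rightarrow> (real^'n) set \<Rightarrow>
     real^'n \<Rightarrow> real^'n \<Rightarrow> real^'n \<Rightarrow> ereal"
  where "s_bar F B C h h0 h1 =
    (SUP x \<in> {h + v + w | v w. v \<in> H_perp B h0 h1 \<and> w \<in> matrix_ran B} \<inter> C.
       ereal (F x \<bullet> (h1 - h0))) / ereal (norm (h1 - h0))"

text \<open>
  Integral of an extended real function as the difference of the integrals of its positive and
  negative parts (\<^const>\<open>e2ennreal\<close> sends negative values to \<open>0\<close>); it is well defined unless
  both are infinite. For \<open>g = 1 / s\<close> the \<^typ>\<open>ereal\<close> convention \<open>1 / 0 = \<infinity>\<close> applies.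
\<close>

definition ext_integral :: "'a measure \<Rightarrow> ('a \<Rightarrow> ereal) \<Rightarrow> ereal"
  where "ext_integral M g =
    enn2ereal (\<integral>\<^sup>+ x. e2ennreal (g x) \<partial>M) - enn2ereal (\<integral>\<^sup>+ x. e2ennreal (- g x) \<partial>M)"

definition ext_integral_defined :: "'a measure \<Rightarrow> ('a \<Rightarrow> ereal) \<Rightarrow> bool"
  where "ext_integral_defined M g \<longleftrightarrow>
    g \<in> borel_measurable M \<and>
    ((\<integral>\<^sup>+ x. e2ennreal (g x) \<partial>M) < \<infinity> \<or> (\<integral>\<^sup>+ x. e2ennreal (- g x) \<partial>M) < \<infinity>)"

definition arc_length_point :: "'a::real_normed_vector \<Rightarrow> 'a \<Rightarrow> real \<Rightarrow> 'a"
  where "arc_length_point a b r = a + (r / norm (b - a)) *\<^sub>R (b - a)"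

definition segment_integral :: "'a::real_normed_vector \<Rightarrow> 'a \<Rightarrow> ('a \<Rightarrow> ereal) \<Rightarrow> ereal"
  where "segment_integral a b g =
    ext_integral (lebesgue_on {0..norm (b - a)}) (\<lambda>r. g (arc_length_point a b r))"

definition segment_integral_defined :: "'a::real_normed_vector \<Rightarrow> 'a \<Rightarrow> ('a \<Rightarrow> ereal) \<Rightarrow> bool"
  where "segment_integral_defined a b g \<longleftrightarrow>
    ext_integral_defined (lebesgue_on {0..norm (b - a)}) (\<lambda>r. g (arc_length_point a b r))"

end

theory Submission
  imports Defs
begin

text \<open>
  Let \<open>y\<close> be a trajectory in \<open>C\<close> from \<open>y0\<close> to \<open>y1\<close> on \<open>{0..T}\<close>, let \<open>e\<close> be the unit vector in the
  direction of \<open>h1 - h0\<close>, and let \<open>q t = (y t - h0) \<bullet> e\<close> be the progress made along the segment. As \<open>e\<close>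
  is orthogonal to the range of \<open>B\<close>, the control does not act on \<open>q\<close>: almost everywhere \<open>q\<close> has the
  derivative \<open>\<phi> t = F (y t) \<bullet> e\<close>, and \<open>\<phi> t \<le> s (q t)\<close>, where \<open>s r\<close> is the value of \<open>s_bar\<close> at the
  point of the segment at distance \<open>r\<close> from \<open>h0\<close>, because \<open>y t\<close> lies in the slice of \<open>C\<close> over that
  point. So a trajectory covers \<open>{0..norm (h1 - h0)}\<close> with speed at most \<open>s\<close>, and should need at least
  the time \<open>\<integral> dr / s r\<close>.

  To make this precise, two obstacles have to be removed. First, \<open>q\<close> need not be monotone, so there is no
  change of variables. For a continuous weight \<open>g\<close> with antiderivative \<open>G\<close> and with
  \<open>g (q t) \<cdot> \<phi> t \<le> 1\<close>, however, \<open>G \<circ> q\<close> is absolutely continuous with derivative at most \<open>1\<close> almost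
  everywhere, so its increment \<open>\<integral> g\<close> is at most \<open>T\<close>
  (\<open>integral_weight_le_time\<close>, based on \<open>fundamental_theorem_of_calculus_abs_continuous\<close>).

  Second, \<open>1 / s\<close> need be neither continuous nor finite. Instead of studying the regularity of \<open>s\<close>, one
  bounds the speed along the given trajectory alone by the sup-convolutions
  \<open>S k r = (SUP t. \<phi> t - k \<cdot> \<bar>q t - r\<bar>)\<close>. These are Lipschitz, satisfy \<open>\<phi> t \<le> S k (q t)\<close>, and, by
  compactness of \<open>{0..T}\<close>, their upper limit for \<open>k \<rightarrow> \<infinity>\<close> is at most the largest speed at which the
  trajectory passes level \<open>r\<close>, hence at most \<open>s r\<close>. The first step applies to
  \<open>g = 1 / (max 0 (S k) + 1 / (k + 1))\<close>, and Fatou's lemma gives \<open>\<integral> 1 / s \<le> T\<close> for the positive part of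
  \<open>1 / s\<close> (\<open>nn_integral_inverse_speed_le_time\<close>), which bounds the extended integral. The infimum over
  all admissible \<open>T\<close> is the controllability time.
\<close>

section \<open>Absolutely continuous functions\<close>

text \<open>
  The definition quantifies over families indexed by natural numbers; for the cells of a tagged
  division the index type has to be arbitrary.
\<close>

lemma abs_continuous_onE:
  assumes "abs_continuous_on a b y" "\<epsilon> > 0"
  obtains \<delta> where "\<delta> > 0"
    "\<And>(I :: 'i set) l r. \<lbrakk>finite I; \<And>i. i \<in> I \<Longrightarrow> a \<le> l i \<and> l i \<le> r i \<and> r i \<le> b;
       disjoint_family_on (\<lambda>i. {l i<..<r i}) I; (\<Sum>i\<in>I. r i - l i) < \<delta>\<rbrakk>
      \<Longrightarrow> (\<Sum>i\<in>I. norm (y (r i) - y (l i))) < \<epsilon>"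
proof -
  obtain \<delta> where "\<delta> > 0" and \<delta>: "\<And>(J :: nat set) l r. finite J \<Longrightarrow>
       (\<forall>i\<in>J. a \<le> l i \<and> l i \<le> r i \<and> r i \<le> b) \<Longrightarrow>
       disjoint_family_on (\<lambda>i. {l i<..<r i}) J \<Longrightarrow>
       (\<Sum>i\<in>J. r i - l i) < \<delta> \<Longrightarrow>
       (\<Sum>i\<in>J. norm (y (r i) - y (l i))) < \<epsilon>"
    using assms unfolding abs_continuous_on_def by meson
  show thesis
  proof (rule that[OF \<open>\<delta> > 0\<close>])
    fix I :: "'i set" and l r
    assume I: "finite I" "\<And>i. i \<in> I \<Longrightarrow> a \<le> l i \<and> l i \<le> r i \<and> r i \<le> b"
      "disjoint_family_on (\<lambda>i. {l i<..<r i}) I" "(\<Sum>i\<in>I. r i - l i) < \<delta>"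
    obtain h where h: "bij_betw h {0..<card I} I"
      using ex_bij_betw_nat_finite[OF I(1)] by blast
    have "(\<Sum>i\<in>{0..<card I}. norm (y ((r \<circ> h) i) - y ((l \<circ> h) i))) < \<epsilon>"
    proof (rule \<delta>)
      show "\<forall>i\<in>{0..<card I}. a \<le> (l \<circ> h) i \<and> (l \<circ> h) i \<le> (r \<circ> h) i \<and> (r \<circ> h) i \<le> b"
        using I(2) bij_betwE[OF h] by simp
      show "disjoint_family_on (\<lambda>i. {(l \<circ> h) i<..<(r \<circ> h) i}) {0..<card I}"
        unfolding disjoint_family_on_def
      proof (intro ballI impI)
        fix i j assume ij: "i \<in> {0..<card I}" "j \<in> {0..<card I}" "i \<noteq> j"
        then have "h i \<noteq> h j" "h i \<in> I" "h j \<in> I"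
          using bij_betwE[OF h] bij_betw_imp_inj_on[OF h] by (auto dest: inj_onD)
        then show "{(l \<circ> h) i<..<(r \<circ> h) i} \<inter> {(l \<circ> h) j<..<(r \<circ> h) j} = {}"
          using disjoint_family_onD[OF I(3)] by simp
      qed
      show "(\<Sum>i\<in>{0..<card I}. (r \<circ> h) i - (l \<circ> h) i) < \<delta>"
        using I(4) sum.reindex_bij_betw[OF h, of "\<lambda>i. r i - l i"] by simp
    qed simp
    then show "(\<Sum>i\<in>I. norm (y (r i) - y (l i))) < \<epsilon>"
      using sum.reindex_bij_betw[OF h, of "\<lambda>i. norm (y (r i) - y (l i))"] by simp
  qed
qed

lemma abs_continuous_on_imp_continuous_on:
  assumes "abs_continuous_on a b y"
  shows "continuous_on {a..b} y"
  unfolding continuous_on_iff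
proof (intro ballI allI impI)
  fix x and \<epsilon> :: real assume x: "x \<in> {a..b}" and "\<epsilon> > 0"
  obtain \<delta> where "\<delta> > 0" and \<delta>: "\<And>(I :: unit set) l r. \<lbrakk>finite I; \<And>i. i \<in> I \<Longrightarrow> a \<le> l i \<and> l i \<le> r i \<and> r i \<le> b;
       disjoint_family_on (\<lambda>i. {l i<..<r i}) I; (\<Sum>i\<in>I. r i - l i) < \<delta>\<rbrakk>
      \<Longrightarrow> (\<Sum>i\<in>I. norm (y (r i) - y (l i))) < \<epsilon>"
    using abs_continuous_onE[OF assms \<open>\<epsilon> > 0\<close>, where 'i = unit] by blast
  have "dist (y x') (y x) < \<epsilon>" if "x' \<in> {a..b}" "dist x' x < \<delta>" for x'
  proof -
    have "norm (y (max x x') - y (min x x')) < \<epsilon>"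
      using \<delta>[of UNIV "\<lambda>_. min x x'" "\<lambda>_. max x x'"] x that
      by (auto simp: disjoint_family_on_def UNIV_unit dist_real_def)
    then show ?thesis
      by (cases "x \<le> x'") (auto simp: dist_norm norm_minus_commute max_def min_def)
  qed
  then show "\<exists>d>0. \<forall>x'\<in>{a..b}. dist x' x < d \<longrightarrow> dist (y x') (y x) < \<epsilon>"
    using \<open>\<delta> > 0\<close> by blast
qed

lemma abs_continuous_on_lipschitz_compose:
  fixes y :: "real \<Rightarrow> 'a::real_normed_vector" and G :: "'a \<Rightarrow> 'b::real_normed_vector"
  assumes y: "abs_continuous_on a b y" and G: "M-lipschitz_on S G" and S: "y ` {a..b} \<subseteq> S"
  shows "abs_continuous_on a b (\<lambda>t. G (y t))"
  unfolding abs_continuous_on_def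
proof (intro allI impI)
  fix \<epsilon> :: real assume "\<epsilon> > 0"
  have "M \<ge> 0" using G by (rule lipschitz_on_nonneg)
  then have "\<epsilon> / (M + 1) > 0" using \<open>\<epsilon> > 0\<close> by simp
  then obtain \<delta> where "\<delta> > 0" and \<delta>: "\<And>(I :: nat set) l r. \<lbrakk>finite I; \<And>i. i \<in> I \<Longrightarrow> a \<le> l i \<and> l i \<le> r i \<and> r i \<le> b;
       disjoint_family_on (\<lambda>i. {l i<..<r i}) I; (\<Sum>i\<in>I. r i - l i) < \<delta>\<rbrakk>
      \<Longrightarrow> (\<Sum>i\<in>I. norm (y (r i) - y (l i))) < \<epsilon> / (M + 1)"
    using abs_continuous_onE[OF y, where 'i = nat] by blast
  have "(\<Sum>i\<in>I. norm (G (y (r i)) - G (y (l i)))) < \<epsilon>"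
    if I: "finite I" "\<forall>i\<in>I. a \<le> l i \<and> l i \<le> r i \<and> r i \<le> b"
      "disjoint_family_on (\<lambda>i. {l i<..<r i}) I" "(\<Sum>i\<in>I. r i - l i) < \<delta>" for I :: "nat set" and l r
  proof -
    have "(\<Sum>i\<in>I. norm (G (y (r i)) - G (y (l i)))) \<le> (\<Sum>i\<in>I. M * norm (y (r i) - y (l i)))"
    proof (rule sum_mono)
      fix i assume "i \<in> I"
      then have "y (r i) \<in> S" "y (l i) \<in> S" using I(2) S by force+
      then show "norm (G (y (r i)) - G (y (l i))) \<le> M * norm (y (r i) - y (l i))"
        using lipschitz_onD[OF G] by (simp add: dist_norm)
    qed
    also have "\<dots> \<le> (M + 1) * (\<Sum>i\<in>I. norm (y (r i) - y (l i)))"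
      by (simp add: sum_distrib_left[symmetric] mult_right_mono sum_nonneg)
    also have "\<dots> < (M + 1) * (\<epsilon> / (M + 1))"
      using \<delta>[OF I(1) _ I(3,4)] I(2) \<open>M \<ge> 0\<close> by (intro mult_strict_left_mono) auto
    finally show ?thesis using \<open>M \<ge> 0\<close> by simp
  qed
  then show "\<exists>\<delta>>0. \<forall>(I :: nat set) l r.
       finite I \<longrightarrow>
       (\<forall>i\<in>I. a \<le> l i \<and> l i \<le> r i \<and> r i \<le> b) \<longrightarrow>
       disjoint_family_on (\<lambda>i. {l i<..<r i}) I \<longrightarrow>
       (\<Sum>i\<in>I. r i - l i) < \<delta> \<longrightarrow>
       (\<Sum>i\<in>I. norm (G (y (r i)) - G (y (l i)))) < \<epsilon>"
    using \<open>\<delta> > 0\<close> by blast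
qed

text \<open>
  The proof works with a gauge. A tag outside the null set \<open>N\<close> gets a ball on which \<open>y\<close> is close to its
  linearisation, as for an everywhere differentiable function. A tag in \<open>N\<close> gets an open set
  \<open>U \<supseteq> N\<close> of small measure; the corresponding cells have small total length, so that absolute
  continuity makes the sum of the increments of \<open>y\<close> over them small, while the integrand may be taken to
  vanish on \<open>N\<close>.
\<close>

lemma fundamental_theorem_of_calculus_abs_continuous:
  fixes y :: "real \<Rightarrow> 'a::banach"
  assumes "a \<le> b" and ac: "abs_continuous_on a b y"
    and N: "negligible N"
    and der: "\<And>t. t \<in> {a..b} - N \<Longrightarrow> (y has_vector_derivative f t) (at t within {a..b})"
  shows "(f has_integral (y b - y a)) {a..b}"
proof -
  define f0 where "f0 t = (if t \<in> N then 0 else f t)" for t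
  have "(f0 has_integral (y b - y a)) {a..b}"
    unfolding has_integral_real
  proof (intro allI impI)
    fix \<epsilon> :: real assume "\<epsilon> > 0"
    define \<eta> where "\<eta> = \<epsilon> / 2 / (b - a + 1)"
    have "\<eta> > 0" using \<open>\<epsilon> > 0\<close> \<open>a \<le> b\<close> by (simp add: \<eta>_def)
    have \<eta>: "\<eta> * (b - a) < \<epsilon> / 2"
      using \<open>\<epsilon> > 0\<close> \<open>a \<le> b\<close> by (simp add: \<eta>_def field_simps)
    obtain \<delta> where "\<delta> > 0" and \<delta>: "\<And>(I :: (real \<times> real set) set) l r. \<lbrakk>finite I; \<And>i. i \<in> I \<Longrightarrow> a \<le> l i \<and> l i \<le> r i \<and> r i \<le> b;
       disjoint_family_on (\<lambda>i. {l i<..<r i}) I; (\<Sum>i\<in>I. r i - l i) < \<delta>\<rbrakk>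
      \<Longrightarrow> (\<Sum>i\<in>I. norm (y (r i) - y (l i))) < \<epsilon> / 2"
      using abs_continuous_onE[OF ac half_gt_zero[OF \<open>\<epsilon> > 0\<close>], where 'i = "real \<times> real set"] by blast
    have "N \<in> sets lebesgue" "emeasure lebesgue N = 0"
      using N by (auto simp: negligible_iff_null_sets)
    obtain U where U: "open U" "N \<subseteq> U" "U - N \<in> lmeasurable" "emeasure lebesgue (U - N) < ennreal \<delta>"
      using sets_lebesgue_outer_open[OF \<open>N \<in> sets lebesgue\<close> \<open>\<delta> > 0\<close>] by blast
    have "U = (U - N) \<union> N" using U(2) by blast
    then have "U \<in> lmeasurable" "measure lebesgue U = measure lebesgue (U - N)"
      using U(3) N negligible_imp_measurable fmeasurable.Un measure_Un_null_set
      by (metis fmeasurableD negligible_iff_null_sets)+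
    moreover have "measure lebesgue (U - N) < \<delta>"
      using U(3,4) \<open>\<delta> > 0\<close> by (simp add: emeasure_eq_measure2 ennreal_less_iff)
    ultimately have mU: "U \<in> lmeasurable" "measure lebesgue U < \<delta>" by auto
    have "\<exists>d>0. \<forall>z\<in>{a..b}. norm (z - t) < d \<longrightarrow> norm (y z - y t - (z - t) *\<^sub>R f t) \<le> \<eta> * norm (z - t)"
      if "t \<in> {a..b} - N" for t
      using der[OF that] \<open>\<eta> > 0\<close> unfolding has_vector_derivative_def has_derivative_within_alt by blast
    then obtain d where d: "\<And>t. t \<in> {a..b} - N \<Longrightarrow> 0 < d t"
      "\<And>t z. \<lbrakk>t \<in> {a..b} - N; z \<in> {a..b}; norm (z - t) < d t\<rbrakk>
        \<Longrightarrow> norm (y z - y t - (z - t) *\<^sub>R f t) \<le> \<eta> * norm (z - t)"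
      by metis
    define \<gamma> where "\<gamma> t = (if t \<in> N then U else if t \<in> {a..b} then ball t (d t) else UNIV)" for t
    have gauge: "gauge \<gamma>"
      using U(1,2) d(1) by (auto simp: gauge_def \<gamma>_def)
    have est: "norm ((\<Sum>(x, K)\<in>p. measure lborel K *\<^sub>R f0 x) - (y b - y a)) < \<epsilon>"
      if p: "p tagged_division_of {a..b}" and fine: "\<gamma> fine p" for p
    proof -
      define E where "E = (\<lambda>(x, K). measure lborel K *\<^sub>R f0 x - (y (Sup K) - y (Inf K)))"
      define pN where "pN = {i \<in> p. fst i \<in> N}"
      have "finite p" using p by blast
      have cell: "x \<in> K \<and> K = {Inf K..Sup K} \<and> a \<le> Inf K \<and> Inf K \<le> Sup K \<and> Sup K \<le> b \<and> K \<subseteq> \<gamma> x"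
        if xK: "(x, K) \<in> p" for x K
      proof -
        obtain u v where K: "K = {u..v}" using tagged_division_ofD(4)[OF p xK] by auto
        moreover have x: "x \<in> K" "K \<subseteq> {a..b}" using tagged_division_ofD[OF p] that by blast+
        ultimately have "u \<le> v" by auto
        then show ?thesis using K x fine that by (auto simp: fine_def)
      qed
      have sub: "norm (E i) \<le> \<eta> * (Sup (snd i) - Inf (snd i))" if i: "i \<in> p - pN" for i
      proof -
        obtain x K where xK: "i = (x, K)" by (cases i)
        then have x: "(x, K) \<in> p" "x \<notin> N" using i by (auto simp: pN_def)
        define u v where "u = Inf K" and "v = Sup K"
        note c = cell[OF x(1), folded u_def v_def]
        then have xab: "x \<in> {a..b} - N" using x by auto
        have bd: "norm (z - x) < d x" if "z \<in> K" for z
          using c that xab by (auto simp: \<gamma>_def dist_real_def)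
        have "u \<in> K" "v \<in> K" using c by (metis atLeastAtMost_iff order_refl)+
        have "u \<le> x" "x \<le> v" using c by (metis atLeastAtMost_iff)+
        have "measure lborel K = v - u" using c by (metis content_real)
        then have "E i = (v - u) *\<^sub>R f x - (y v - y u)"
          using x by (simp add: E_def xK u_def[symmetric] v_def[symmetric] f0_def)
        also have "\<dots> = (y u - y x - (u - x) *\<^sub>R f x) - (y v - y x - (v - x) *\<^sub>R f x)"
          by (simp add: algebra_simps)
        finally have "norm (E i) \<le> norm (y u - y x - (u - x) *\<^sub>R f x) + norm (y v - y x - (v - x) *\<^sub>R f x)"
          by (simp only: norm_triangle_ineq4)
        also have "\<dots> \<le> \<eta> * norm (u - x) + \<eta> * norm (v - x)"
          using bd \<open>u \<in> K\<close> \<open>v \<in> K\<close> c xab by (intro add_mono d(2)) auto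
        also have "\<dots> = \<eta> * (v - u)"
          using \<open>u \<le> x\<close> \<open>x \<le> v\<close> by (simp add: algebra_simps)
        finally show ?thesis by (simp add: xK u_def v_def)
      qed
      have "(\<Sum>i\<in>p - pN. norm (E i)) \<le> (\<Sum>i\<in>p - pN. \<eta> * (Sup (snd i) - Inf (snd i)))"
        by (rule sum_mono[OF sub])
      also have "\<dots> \<le> (\<Sum>i\<in>p. \<eta> * (Sup (snd i) - Inf (snd i)))"
        using \<open>finite p\<close> cell \<open>\<eta> > 0\<close> by (intro sum_mono2) auto
      also have "\<dots> = \<eta> * (b - a)"
        using additive_tagged_division_1[OF \<open>a \<le> b\<close> p, of "\<lambda>x. x"]
        by (simp add: sum_distrib_left[symmetric] split_def)
      finally have good: "(\<Sum>i\<in>p - pN. norm (E i)) < \<epsilon> / 2" using \<eta> by linarith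
      have disj: "disjoint_family_on (\<lambda>i. {Inf (snd i)<..<Sup (snd i)}) pN"
        unfolding disjoint_family_on_def
      proof (intro ballI impI)
        fix i j assume ij: "i \<in> pN" "j \<in> pN" "i \<noteq> j"
        obtain x K x' K' where e: "i = (x, K)" "j = (x', K')" by (metis surj_pair)
        then have m: "(x, K) \<in> p" "(x', K') \<in> p" "(x, K) \<noteq> (x', K')" using ij by (auto simp: pN_def)
        have "interior K = {Inf K<..<Sup K}" "interior K' = {Inf K'<..<Sup K'}"
          using cell[OF m(1)] cell[OF m(2)] interior_atLeastAtMost_real by metis+
        then show "{Inf (snd i)<..<Sup (snd i)} \<inter> {Inf (snd j)<..<Sup (snd j)} = {}"
          using tagged_division_ofD(5)[OF p m] e by simp
      qed
      have "(\<Sum>i\<in>pN. Sup (snd i) - Inf (snd i)) = (\<Sum>i\<in>pN. measure lebesgue {Inf (snd i)<..<Sup (snd i)})"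
        by (intro sum.cong) (use cell in \<open>auto simp: pN_def\<close>)
      also have "\<dots> = measure lebesgue (\<Union>i\<in>pN. {Inf (snd i)<..<Sup (snd i)})"
        using \<open>finite p\<close> cell by (intro measure_finite_Union[symmetric] disj) (auto simp: pN_def)
      also have "\<dots> \<le> measure lebesgue U"
      proof (rule measure_mono_fmeasurable)
        show "(\<Union>i\<in>pN. {Inf (snd i)<..<Sup (snd i)}) \<subseteq> U"
        proof clarsimp
          fix x K z assume xK: "(x, K) \<in> pN" and z: "Inf K < z" "z < Sup K"
          then have "K \<subseteq> U" "K = {Inf K..Sup K}"
            using cell[of x K] by (auto simp: pN_def \<gamma>_def)
          then show "z \<in> U" using z by (metis atLeastAtMost_iff less_imp_le subsetD)
        qed
        show "(\<Union>i\<in>pN. {Inf (snd i)<..<Sup (snd i)}) \<in> sets lebesgue"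
          by (intro sets_completionI_sets) (auto intro!: borel_open open_UN)
      qed (use mU in auto)
      finally have "(\<Sum>i\<in>pN. Sup (snd i) - Inf (snd i)) < \<delta>" using mU by linarith
      then have "(\<Sum>i\<in>pN. norm (y (Sup (snd i)) - y (Inf (snd i)))) < \<epsilon> / 2"
        using \<open>finite p\<close> cell by (intro \<delta> disj) (auto simp: pN_def)
      also have "(\<Sum>i\<in>pN. norm (y (Sup (snd i)) - y (Inf (snd i)))) = (\<Sum>i\<in>pN. norm (E i))"
        by (intro sum.cong) (auto simp: pN_def E_def f0_def norm_minus_commute)
      finally have bad: "(\<Sum>i\<in>pN. norm (E i)) < \<epsilon> / 2" .
      have "(\<Sum>(x, K)\<in>p. measure lborel K *\<^sub>R f0 x) - (y b - y a) = (\<Sum>i\<in>p. E i)"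
        using additive_tagged_division_1[OF \<open>a \<le> b\<close> p, of y]
        by (simp add: E_def sum_subtractf split_def)
      also have "norm \<dots> \<le> (\<Sum>i\<in>p. norm (E i))" by (rule norm_sum)
      also have "\<dots> = (\<Sum>i\<in>p - pN. norm (E i)) + (\<Sum>i\<in>pN. norm (E i))"
        using \<open>finite p\<close> by (intro sum.subset_diff) (auto simp: pN_def)
      finally show ?thesis using good bad by linarith
    qed
    show "\<exists>\<gamma>. gauge \<gamma> \<and> (\<forall>p. p tagged_division_of {a..b} \<and> \<gamma> fine p \<longrightarrow>
        norm ((\<Sum>(x, K)\<in>p. measure lborel K *\<^sub>R f0 x) - (y b - y a)) < \<epsilon>)"
    proof (intro exI conjI allI impI)
      show "gauge \<gamma>" by (rule gauge)
    next
      fix p assume "p tagged_division_of {a..b} \<and> \<gamma> fine p"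
      then show "norm ((\<Sum>(x, K)\<in>p. measure lborel K *\<^sub>R f0 x) - (y b - y a)) < \<epsilon>"
        using est by simp
    qed
  qed
  then show ?thesis
    by (rule has_integral_spike[OF N, rotated]) (simp add: f0_def)
qed

section \<open>Travel time under a speed limit\<close>

text \<open>
  If \<open>G\<close> is an antiderivative of \<open>g\<close>, then \<open>G \<circ> q\<close> is absolutely continuous and grows at rate
  \<open>g (q t) \<cdot> \<phi> t \<le> 1\<close>. This is a substitution that does not require \<open>q\<close> to be monotone: \<open>q\<close> may leave
  \<open>{q a..q b}\<close> and come back, at no cost, because only the end points of \<open>G \<circ> q\<close> count.
\<close>

lemma integral_weight_le_time:
  fixes q \<phi> g :: "real \<Rightarrow> real"
  assumes "a \<le> b" and q: "abs_continuous_on a b q" and "negligible N"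
    and der: "\<And>t. t \<in> {a..b} - N \<Longrightarrow> (q has_vector_derivative \<phi> t) (at t within {a..b})"
    and g: "continuous_on UNIV g"
    and bound: "\<And>t. t \<in> {a..b} \<Longrightarrow> g (q t) * \<phi> t \<le> 1"
    and "q a \<le> q b"
  shows "integral {q a..q b} g \<le> b - a"
proof -
  have "bounded (q ` {a..b})"
    using abs_continuous_on_imp_continuous_on[OF q]
    by (intro compact_imp_bounded compact_continuous_image) auto
  then obtain R where "\<forall>x\<in>q ` {a..b}. \<bar>x\<bar> \<le> R"
    unfolding bounded_iff real_norm_def ..
  then have R: "\<bar>x\<bar> \<le> R" if "x \<in> q ` {a..b}" for x
    using that by (rule bspec)
  have range: "q ` {a..b} \<subseteq> {-R..R}"
  proof
    fix x assume "x \<in> q ` {a..b}"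
    then show "x \<in> {-R..R}" using R[of x] by (simp add: abs_le_iff)
  qed
  have gR: "continuous_on {-R..R} g" using g continuous_on_subset by blast
  define G where "G r = integral {-R..r} g" for r
  have G: "(G has_vector_derivative g r) (at r within {-R..R})" if "r \<in> {-R..R}" for r
    unfolding G_def by (rule integral_has_vector_derivative[OF gR that])
  have "bounded (g ` {-R..R})"
    by (intro compact_imp_bounded compact_continuous_image gR) simp
  then obtain M where "\<forall>x\<in>g ` {-R..R}. \<bar>x\<bar> \<le> M"
    unfolding bounded_iff real_norm_def ..
  then have M: "\<bar>g r\<bar> \<le> M" if "r \<in> {-R..R}" for r
    using that by blast
  have "R \<ge> 0" using R[of "q a"] \<open>a \<le> b\<close> by fastforce
  have "M-lipschitz_on {-R..R} G"
  proof (rule bounded_derivative_imp_lipschitz)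
    show "(G has_derivative (\<lambda>x. x *\<^sub>R g r)) (at r within {-R..R})" if "r \<in> {-R..R}" for r
      using G[OF that] by (simp add: has_vector_derivative_def)
    show "onorm (\<lambda>x. x *\<^sub>R g r) \<le> M" if "r \<in> {-R..R}" for r
      using M[OF that]
      by (intro onorm_le) (simp add: abs_mult mult.commute[of M] mult_left_mono)
    show "0 \<le> M" using M[of 0] \<open>R \<ge> 0\<close> by auto
  qed simp
  then have "abs_continuous_on a b (\<lambda>t. G (q t))"
    by (rule abs_continuous_on_lipschitz_compose[OF q _ range])
  moreover have "((\<lambda>t. G (q t)) has_vector_derivative \<phi> t *\<^sub>R g (q t)) (at t within {a..b})"
    if "t \<in> {a..b} - N" for t
  proof -
    have "q t \<in> {-R..R}" using range that by blast
    from vector_diff_chain_within[OF der[OF that] has_vector_derivative_within_subset[OF G[OF this] range]]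
    show ?thesis by (simp add: o_def)
  qed
  ultimately have "((\<lambda>t. \<phi> t *\<^sub>R g (q t)) has_integral (G (q b) - G (q a))) {a..b}"
    by (rule fundamental_theorem_of_calculus_abs_continuous[OF \<open>a \<le> b\<close> _ \<open>negligible N\<close>])
  moreover have "((\<lambda>t. 1) has_integral (b - a)) {a..b}"
    using has_integral_const_real[of "1::real" a b] \<open>a \<le> b\<close> by simp
  ultimately have "G (q b) - G (q a) \<le> b - a"
    by (rule has_integral_le) (use bound in \<open>simp add: mult.commute\<close>)
  moreover have "q a \<in> {-R..R}" "q b \<in> {-R..R}"
    using \<open>a \<le> b\<close> by (intro subsetD[OF range] imageI; simp)+
  then have "integral {-R..q a} g + integral {q a..q b} g = integral {-R..q b} g"
    using \<open>q a \<le> q b\<close> by (intro Henstock_Kurzweil_Integration.integral_combine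
        integrable_continuous_interval continuous_on_subset[OF g]) auto
  ultimately show ?thesis by (simp add: G_def)
qed

text \<open>
  A supremum of functions of \<open>r\<close> that are all \<open>k\<close>-Lipschitz is \<open>k\<close>-Lipschitz.
\<close>

lemma continuous_on_sup_convolution:
  fixes p q :: "'a \<Rightarrow> real"
  assumes "A \<noteq> {}" and bdd: "\<And>t. t \<in> A \<Longrightarrow> p t \<le> K" and "k \<ge> 0"
  shows "continuous_on UNIV (\<lambda>r. SUP t\<in>A. p t - k * \<bar>q t - r\<bar>)"
proof -
  let ?S = "\<lambda>r. SUP t\<in>A. p t - k * \<bar>q t - r\<bar>"
  have "?S r \<le> ?S s + k * \<bar>r - s\<bar>" for r s
  proof (rule cSUP_least[OF \<open>A \<noteq> {}\<close>])
    fix t assume "t \<in> A"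
    have "k * \<bar>q t - s\<bar> \<le> k * (\<bar>q t - r\<bar> + \<bar>r - s\<bar>)"
      using \<open>k \<ge> 0\<close> by (intro mult_left_mono) auto
    moreover have "p t - k * \<bar>q t - s\<bar> \<le> ?S s"
    proof (rule cSUP_upper[OF \<open>t \<in> A\<close>])
      have "p u - k * \<bar>q u - s\<bar> \<le> K" if "u \<in> A" for u
        using bdd[OF that] mult_nonneg_nonneg[OF \<open>k \<ge> 0\<close> abs_ge_zero] by (smt (verit))
      then show "bdd_above ((\<lambda>t. p t - k * \<bar>q t - s\<bar>) ` A)"
        by (rule bdd_aboveI2)
    qed
    ultimately show "p t - k * \<bar>q t - r\<bar> \<le> ?S s + k * \<bar>r - s\<bar>"
      by (simp add: distrib_left)
  qed
  note le = this
  have "\<bar>?S r - ?S s\<bar> \<le> k * \<bar>r - s\<bar>" for r s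
    using le[of r s] le[of s r] by (simp add: abs_le_iff abs_minus_commute)
  then have "k-lipschitz_on UNIV ?S"
    using \<open>k \<ge> 0\<close> by (intro lipschitz_onI) (auto simp: dist_real_def)
  then show ?thesis by (rule lipschitz_on_continuous_on)
qed

text \<open>
  For large \<open>k\<close> the penalty \<open>k \<cdot> \<bar>q t - r\<bar>\<close> outweighs \<open>p t\<close> on the compact set of those \<open>t\<close> with
  \<open>p t \<ge> \<beta>\<close>, because \<open>q\<close> stays at a positive distance from \<open>r\<close> there. So in the limit only the values of
  \<open>p\<close> on the fibre of \<open>q\<close> over \<open>r\<close> matter.
\<close>

lemma eventually_sup_convolution_le:
  fixes p q :: "'a::topological_space \<Rightarrow> real"
  assumes "compact A" "A \<noteq> {}" and p: "continuous_on A p" and q: "continuous_on A q"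
    and less: "\<And>t. \<lbrakk>t \<in> A; q t = r\<rbrakk> \<Longrightarrow> p t < \<beta>"
  shows "\<forall>\<^sub>F k in sequentially. (SUP t\<in>A. p t - real k * \<bar>q t - r\<bar>) \<le> \<beta>"
proof -
  define D where "D = A \<inter> p -` {\<beta>..}"
  have "compact D"
    using continuous_closedin_preimage[OF p closed_atLeast] closedin_compact[OF \<open>compact A\<close>]
    unfolding D_def by blast
  obtain K where K: "\<And>t. t \<in> A \<Longrightarrow> p t \<le> K"
    using continuous_attains_sup[OF \<open>compact A\<close> \<open>A \<noteq> {}\<close> p] by blast
  obtain \<eta> where "\<eta> > 0" and \<eta>: "\<And>t. t \<in> D \<Longrightarrow> \<eta> \<le> \<bar>q t - r\<bar>"
  proof (cases "D = {}")
    case False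
    have "continuous_on D (\<lambda>t. \<bar>q t - r\<bar>)"
      using q by (intro continuous_intros continuous_on_subset[OF q]) (auto simp: D_def)
    then obtain t where t: "t \<in> D" "\<And>s. s \<in> D \<Longrightarrow> \<bar>q t - r\<bar> \<le> \<bar>q s - r\<bar>"
      using continuous_attains_inf[OF \<open>compact D\<close> False] by blast
    moreover have "q t \<noteq> r" using less[of t] t(1) by (auto simp: D_def)
    ultimately show thesis by (intro that[of "\<bar>q t - r\<bar>"]) auto
  qed (auto intro: that[of 1])
  have "\<forall>\<^sub>F k in sequentially. (K - \<beta>) / \<eta> \<le> real k"
    by (rule eventually_sequentiallyI[of "nat \<lceil>(K - \<beta>) / \<eta>\<rceil>"]) linarith
  then show ?thesis
  proof eventually_elim
    case (elim k)
    have "p t - real k * \<bar>q t - r\<bar> \<le> \<beta>" if "t \<in> A" for t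
    proof (cases "t \<in> D")
      case True
      have "K - \<beta> \<le> real k * \<eta>" using elim \<open>\<eta> > 0\<close> by (simp add: field_simps)
      also have "\<dots> \<le> real k * \<bar>q t - r\<bar>" using \<eta>[OF True] by (simp add: mult_left_mono)
      finally show ?thesis using K[OF that] by linarith
    next
      case False
      then have "p t < \<beta>" using that by (auto simp: D_def)
      moreover have "0 \<le> real k * \<bar>q t - r\<bar>" by simp
      ultimately show ?thesis by linarith
    qed
    then show ?case using \<open>A \<noteq> {}\<close> by (intro cSUP_least)
  qed
qed

text \<open>
  If \<open>\<sigma>\<close> were finite, continuous and positive, the previous bound could be used with \<open>g = 1 / \<sigma>\<close>.
  In general \<open>\<sigma>\<close> is replaced by continuous functions \<open>M k > 0\<close> that still dominate the speed \<open>\<phi>\<close> along the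
  trajectory, but whose upper limit is at most \<open>\<sigma>\<close> wherever \<open>\<sigma> \<ge> 0\<close>: the positive parts of the sup-convolutions
  of \<open>\<phi>\<close>, shifted up by \<open>1 / (k + 1)\<close>. Fatou's lemma then passes to the limit.
\<close>

lemma nn_integral_inverse_speed_le_time:
  fixes q \<phi> :: "real \<Rightarrow> real" and \<sigma> :: "real \<Rightarrow> ereal"
  assumes "a \<le> b" and q: "abs_continuous_on a b q" and N: "negligible N"
    and der: "\<And>t. t \<in> {a..b} - N \<Longrightarrow> (q has_vector_derivative \<phi> t) (at t within {a..b})"
    and \<phi>: "continuous_on {a..b} \<phi>"
    and \<sigma>: "\<And>t. t \<in> {a..b} \<Longrightarrow> ereal (\<phi> t) \<le> \<sigma> (q t)"
    and "q a \<le> q b"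
  shows "(\<integral>\<^sup>+ r. e2ennreal (1 / \<sigma> r) \<partial>lebesgue_on {q a..q b}) \<le> ennreal (b - a)"
proof -
  note contq = abs_continuous_on_imp_continuous_on[OF q]
  have ne: "{a..b} \<noteq> {}" using \<open>a \<le> b\<close> by simp
  obtain K where K: "\<And>t. t \<in> {a..b} \<Longrightarrow> \<phi> t \<le> K"
    using continuous_attains_sup[OF compact_Icc ne \<phi>] by blast
  define S where "S k r = (SUP t\<in>{a..b}. \<phi> t - real k * \<bar>q t - r\<bar>)" for k :: nat and r
  define M where "M k r = max 0 (S k r) + inverse (real (Suc k))" for k :: nat and r
  have contS: "continuous_on UNIV (S k)" for k
    unfolding S_def using continuous_on_sup_convolution[OF ne K] by simp
  have Mpos: "M k r > 0" for k r
    by (simp add: M_def add_nonneg_pos)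
  have contM: "continuous_on UNIV (\<lambda>r. 1 / M k r)" for k
  proof -
    have "continuous_on UNIV (M k)" unfolding M_def by (intro continuous_intros contS)
    moreover have "M k r \<noteq> 0" for r using Mpos[of k r] by simp
    ultimately show ?thesis by (intro continuous_intros) auto
  qed
  have le_M: "\<phi> t \<le> M k (q t)" if "t \<in> {a..b}" for t k
  proof -
    have "\<phi> t - real k * \<bar>q t - q t\<bar> \<le> S k (q t)"
      unfolding S_def
    proof (rule cSUP_upper[OF that])
      have "\<phi> u - real k * \<bar>q u - q t\<bar> \<le> K" if "u \<in> {a..b}" for u
      proof -
        have "0 \<le> real k * \<bar>q u - q t\<bar>" by simp
        then show ?thesis using K[OF that] by linarith
      qed
      then show "bdd_above ((\<lambda>u. \<phi> u - real k * \<bar>q u - q t\<bar>) ` {a..b})"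
        by (rule bdd_aboveI2)
    qed
    then have "\<phi> t \<le> S k (q t)" by simp
    moreover have "inverse (real (Suc k)) > 0" by simp
    ultimately show ?thesis unfolding M_def by linarith
  qed
  have bound: "(\<integral>\<^sup>+ r. ennreal (1 / M k r) \<partial>lebesgue_on {q a..q b}) \<le> ennreal (b - a)" for k
  proof -
    have int: "integrable (lebesgue_on {q a..q b}) (\<lambda>r. 1 / M k r)"
      by (intro continuous_imp_integrable_real continuous_on_subset[OF contM]) auto
    have "integral\<^sup>L (lebesgue_on {q a..q b}) (\<lambda>r. 1 / M k r) = integral {q a..q b} (\<lambda>r. 1 / M k r)"
      using int by (rule lebesgue_integral_eq_integral) simp
    also have "\<dots> \<le> b - a"
      by (rule integral_weight_le_time[OF \<open>a \<le> b\<close> q N der contM _ \<open>q a \<le> q b\<close>])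
        (use le_M Mpos in \<open>auto simp: divide_le_eq\<close>)
    finally show ?thesis
      using nn_integral_eq_integral[OF int] Mpos by (simp add: less_imp_le ennreal_leI)
  qed
  have lim: "e2ennreal (1 / \<sigma> r) \<le> liminf (\<lambda>k. ennreal (1 / M k r))" for r
    unfolding le_Liminf_iff
  proof (intro allI impI)
    fix y assume y: "y < e2ennreal (1 / \<sigma> r)"
    then obtain c where c: "y = ennreal c" "c \<ge> 0"
      by (cases y) (auto simp: top.not_eq_extremum[symmetric])
    have c_less: "ereal c < 1 / \<sigma> r"
      using y c by (metis e2ennreal_ereal e2ennreal_mono not_le)
    \<comment> \<open>A strict lower bound \<open>c \<ge> 0\<close> for \<open>1 / \<sigma> r\<close> excludes \<open>\<sigma> r < 0\<close> and \<open>\<sigma> r = \<infinity>\<close>; the form \<open>c \<cdot> s < 1\<close>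
      also covers \<open>\<sigma> r = 0\<close>, where \<open>1 / \<sigma> r = \<infinity>\<close>.\<close>
    obtain s where s: "\<sigma> r = ereal s" "s \<ge> 0" "c * s < 1"
    proof (cases "\<sigma> r")
      case (real s)
      show thesis
      proof (cases "s = 0")
        case False
        then have "c < 1 / s" using c_less real by (simp add: one_ereal_def)
        then have "0 < 1 / s" using c(2) by linarith
        then have "s > 0" by simp
        then show thesis using \<open>c < 1 / s\<close> real by (intro that[of s]) (auto simp: field_simps)
      qed (use real that[of 0] in auto)
    qed (use c_less c(2) in \<open>auto simp: zero_ereal_def[symmetric]\<close>)
    obtain \<beta> where \<beta>: "s < \<beta>" "c * \<beta> < 1"
    proof (cases "c = 0")
      case False
      then have "s < 1 / c" using c s by (simp add: field_simps)
      then obtain \<beta> where "s < \<beta>" "\<beta> < 1 / c" using dense by blast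
      then show thesis using that False c(2) by (simp add: field_simps)
    qed (use that[of "s + 1"] in auto)
    obtain \<beta>' where \<beta>': "s < \<beta>'" "\<beta>' < \<beta>" using dense[OF \<beta>(1)] by blast
    have "\<forall>\<^sub>F k in sequentially. S k r \<le> \<beta>'"
      unfolding S_def
    proof (rule eventually_sup_convolution_le[OF compact_Icc ne \<phi> contq])
      show "\<phi> t < \<beta>'" if "t \<in> {a..b}" "q t = r" for t
        using \<sigma>[OF that(1)] that(2) s(1) \<beta>'(1) by simp
    qed
    moreover have "\<forall>\<^sub>F k in sequentially. inverse (real (Suc k)) < \<beta> - \<beta>'"
      using order_tendstoD(2)[OF LIMSEQ_inverse_real_of_nat, of "\<beta> - \<beta>'"] \<beta>'(2) by simp
    ultimately show "\<forall>\<^sub>F k in sequentially. y < ennreal (1 / M k r)"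
    proof eventually_elim
      case (elim k)
      then have "M k r \<le> \<beta>" using \<beta>' s(2) by (simp add: M_def)
      then have "c * M k r \<le> c * \<beta>" using c(2) by (simp add: mult_left_mono)
      then have "c < 1 / M k r" using \<beta>(2) Mpos[of k r] by (simp add: less_divide_eq)
      then show ?case using c by (simp add: ennreal_less_iff)
    qed
  qed
  have "(\<integral>\<^sup>+ r. e2ennreal (1 / \<sigma> r) \<partial>lebesgue_on {q a..q b})
      \<le> (\<integral>\<^sup>+ r. liminf (\<lambda>k. ennreal (1 / M k r)) \<partial>lebesgue_on {q a..q b})"
    by (rule nn_integral_mono) (rule lim)
  also have "\<dots> \<le> liminf (\<lambda>k. \<integral>\<^sup>+ r. ennreal (1 / M k r) \<partial>lebesgue_on {q a..q b})"
  proof (rule nn_integral_liminf)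
    show "(\<lambda>r. ennreal (1 / M k r)) \<in> borel_measurable (lebesgue_on {q a..q b})" for k
      by (intro measurable_compose[OF _ measurable_ennreal] continuous_imp_measurable_on_sets_lebesgue
          continuous_on_subset[OF contM]) auto
  qed
  also have "\<dots> \<le> ennreal (b - a)"
  proof -
    have "liminf (\<lambda>k. \<integral>\<^sup>+ r. ennreal (1 / M k r) \<partial>lebesgue_on {q a..q b})
        \<le> liminf (\<lambda>k :: nat. ennreal (b - a))"
      by (intro Liminf_mono always_eventually allI bound)
    then show ?thesis by (simp add: Liminf_const)
  qed
  finally show ?thesis .
qed

section \<open>Progress of a trajectory along the segment\<close>

lemma subspace_matrix_ran: "subspace (matrix_ran B)"
  unfolding matrix_ran_def by (intro linear_subspace_image) auto

lemma subspace_H_space: "subspace (H_space B)"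
  unfolding H_space_def by (rule subspace_orthogonal_comp)

lemma inner_matrix_ran_H_space:
  assumes "w \<in> matrix_ran B" "d \<in> H_space B"
  shows "w \<bullet> d = 0"
  using assms by (auto simp: H_space_def orthogonal_comp_def orthogonal_def)

lemma orthogonal_comp_H_space: "orthogonal_comp (H_space B) = matrix_ran B"
  unfolding H_space_def by (rule orthogonal_comp_self[OF subspace_matrix_ran])

lemma inner_orth_proj_H_space:
  assumes "d \<in> H_space B"
  shows "orth_proj (H_space B) y \<bullet> d = y \<bullet> d"
proof -
  have "(y - orth_proj (H_space B) y) \<bullet> d = 0"
    using orth_proj_in(2)[OF subspace_H_space, of y B] assms
    by (intro inner_matrix_ran_H_space) (simp add: orthogonal_comp_H_space)
  then show ?thesis by (simp add: inner_diff_left)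
qed

text \<open>
  The slice is the whole hyperplane through \<open>h\<close> orthogonal to \<open>h1 - h0\<close>: the projection of \<open>x - h\<close> to
  \<open>H\<close> is the component in \<open>H_perp\<close>, and the rest lies in the range of \<open>B\<close>.
\<close>

lemma slice_memI:
  assumes d: "h1 - h0 \<in> H_space B"
    and x: "(x - h) \<bullet> (h1 - h0) = 0"
  shows "x \<in> {h + v + w | v w. v \<in> H_perp B h0 h1 \<and> w \<in> matrix_ran B}"
proof -
  define v where "v = orth_proj (H_space B) (x - h)"
  have "v \<in> H_perp B h0 h1"
    using orth_proj_in(1)[OF subspace_H_space] inner_orth_proj_H_space[OF d, of "x - h"] x
    by (simp add: H_perp_def v_def orthogonal_def)
  moreover have "x - h - v \<in> matrix_ran B"
    using orth_proj_in(2)[OF subspace_H_space, of "x - h" B] by (simp add: v_def orthogonal_comp_H_space)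
  moreover have "x = h + v + (x - h - v)" by simp
  ultimately show ?thesis by blast
qed

lemma speed_le_s_bar:
  assumes d: "h1 - h0 \<in> H_space B" and "h0 \<noteq> h1" and "x \<in> C"
  shows "ereal (F x \<bullet> (h1 - h0) / norm (h1 - h0))
    \<le> s_bar F B C (arc_length_point h0 h1 ((x - h0) \<bullet> (h1 - h0) / norm (h1 - h0))) h0 h1"
proof -
  let ?h = "arc_length_point h0 h1 ((x - h0) \<bullet> (h1 - h0) / norm (h1 - h0))"
  have "norm (h1 - h0) > 0" using \<open>h0 \<noteq> h1\<close> by simp
  then have "(x - ?h) \<bullet> (h1 - h0) = 0"
    by (simp add: arc_length_point_def inner_diff_left inner_add_left dot_square_norm power2_eq_square)
  then have "ereal (F x \<bullet> (h1 - h0)) \<le>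
      (SUP x \<in> {?h + v + w | v w. v \<in> H_perp B h0 h1 \<and> w \<in> matrix_ran B} \<inter> C. ereal (F x \<bullet> (h1 - h0)))"
    by (intro SUP_upper IntI slice_memI[OF d] \<open>x \<in> C\<close>)
  then have "ereal (F x \<bullet> (h1 - h0)) / ereal (norm (h1 - h0)) \<le> s_bar F B C ?h h0 h1"
    unfolding s_bar_def using \<open>norm (h1 - h0) > 0\<close> by (intro ereal_divide_right_mono) simp_all
  then show ?thesis using \<open>norm (h1 - h0) > 0\<close> by simp
qed

lemma AE_lebesgue_on_imp_negligible:
  assumes "AE t in lebesgue_on S. P t" and "S \<in> sets lebesgue"
  obtains N where "negligible N" "\<And>t. t \<in> S - N \<Longrightarrow> P t"
proof -
  have "AE t in lebesgue. t \<in> S \<longrightarrow> P t"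
    using assms AE_restrict_space_iff[of S lebesgue P] by simp
  then obtain N where "N \<in> null_sets lebesgue" "{t \<in> space lebesgue. \<not> (t \<in> S \<longrightarrow> P t)} \<subseteq> N"
    unfolding eventually_ae_filter by blast
  then show thesis by (intro that[of N]) (auto simp: negligible_iff_null_sets)
qed

text \<open>
  The coordinate \<open>q t\<close> of \<open>y t - h0\<close> along the unit vector \<open>e\<close> runs from \<open>0\<close> to the length of the segment.
  Since \<open>e\<close> is orthogonal to the range of \<open>B\<close>, the control drops out of its derivative, which is the
  continuous function \<open>F (y t) \<bullet> e\<close>.
\<close>

lemma nn_integral_inverse_s_bar_le_time:
  fixes F :: "real^'n \<Rightarrow> real^'n" and B :: "real^'m^'n"
  assumes F: "continuous_on UNIV F" and "T \<ge> 0"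
    and sol: "control_solution F B T u y" and C: "\<And>t. t \<in> {0..T} \<Longrightarrow> y t \<in> C"
    and h0: "h0 = orth_proj (H_space B) (y 0)" and h1: "h1 = orth_proj (H_space B) (y T)"
    and "h0 \<noteq> h1"
  shows "(\<integral>\<^sup>+ r. e2ennreal (1 / s_bar F B C (arc_length_point h0 h1 r) h0 h1)
      \<partial>lebesgue_on {0..norm (h1 - h0)}) \<le> ennreal T"
proof -
  define e where "e = (h1 - h0) /\<^sub>R norm (h1 - h0)"
  define q where "q t = (y t - h0) \<bullet> e" for t
  have d: "h1 - h0 \<in> H_space B"
    unfolding h0 h1 by (intro subspace_diff[OF subspace_H_space] orth_proj_in(1)[OF subspace_H_space])
  have e: "e \<in> H_space B"
    unfolding e_def by (rule subspace_mul[OF subspace_H_space d])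
  have "norm e = 1" using \<open>h0 \<noteq> h1\<close> by (simp add: e_def)
  have inner_e: "x \<bullet> e = x \<bullet> (h1 - h0) / norm (h1 - h0)" for x
    by (simp add: e_def divide_inverse mult.commute)
  have "q 0 = 0"
    using inner_orth_proj_H_space[OF e, of "y 0"] by (simp add: q_def h0 inner_diff_left)
  have "q T = norm (h1 - h0)"
  proof -
    have "q T = (h1 - h0) \<bullet> e"
      using inner_orth_proj_H_space[OF e, of "y T"] by (simp add: q_def h1 inner_diff_left)
    then show ?thesis using \<open>h0 \<noteq> h1\<close> by (simp add: inner_e dot_square_norm power2_eq_square)
  qed
  have y: "abs_continuous_on 0 T y"
    using sol by (simp add: control_solution_def)
  have "1-lipschitz_on UNIV (\<lambda>x. (x - h0) \<bullet> e)"
  proof (rule lipschitz_onI)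
    show "dist ((x - h0) \<bullet> e) ((x' - h0) \<bullet> e) \<le> 1 * dist x x'" for x x'
      using Cauchy_Schwarz_ineq2[of "x - x'" e] \<open>norm e = 1\<close>
      by (simp add: dist_norm inner_diff_left)
  qed simp
  then have q: "abs_continuous_on 0 T q"
    unfolding q_def by (rule abs_continuous_on_lipschitz_compose[OF y]) simp
  obtain N where "negligible N" and N: "\<And>t. t \<in> {0..T} - N \<Longrightarrow>
      (y has_vector_derivative F (y t) + B *v u t) (at t within {0..T})"
  proof (rule AE_lebesgue_on_imp_negligible)
    show "AE t in lebesgue_on {0..T}.
        (y has_vector_derivative F (y t) + B *v u t) (at t within {0..T})"
      using sol by (simp add: control_solution_def)
  qed auto
  have der: "(q has_vector_derivative F (y t) \<bullet> e) (at t within {0..T})" if "t \<in> {0..T} - N" for t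
  proof -
    have "(q has_vector_derivative (F (y t) + B *v u t) \<bullet> e) (at t within {0..T})"
      unfolding q_def using bounded_linear.has_vector_derivative[OF bounded_linear_inner_left
          has_vector_derivative_diff[OF N[OF that] has_vector_derivative_const[of h0]]]
      by simp
    moreover have "(B *v u t) \<bullet> e = 0"
      by (rule inner_matrix_ran_H_space[OF _ e]) (simp add: matrix_ran_def)
    ultimately show ?thesis by (simp add: inner_add_left)
  qed
  have cont: "continuous_on {0..T} (\<lambda>t. F (y t) \<bullet> e)"
    by (intro continuous_intros continuous_on_compose2[OF F] abs_continuous_on_imp_continuous_on[OF y]) simp
  have "(\<integral>\<^sup>+ r. e2ennreal (1 / s_bar F B C (arc_length_point h0 h1 r) h0 h1)
      \<partial>lebesgue_on {q 0..q T}) \<le> ennreal (T - 0)"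
  proof (rule nn_integral_inverse_speed_le_time[OF \<open>T \<ge> 0\<close> q \<open>negligible N\<close> der cont])
    show "ereal (F (y t) \<bullet> e) \<le> s_bar F B C (arc_length_point h0 h1 (q t)) h0 h1" if "t \<in> {0..T}" for t
      unfolding q_def inner_e by (rule speed_le_s_bar[OF d \<open>h0 \<noteq> h1\<close> C[OF that]])
    show "q 0 \<le> q T" by (simp add: \<open>q 0 = 0\<close> \<open>q T = norm (h1 - h0)\<close>)
  qed
  then show ?thesis by (simp add: \<open>q 0 = 0\<close> \<open>q T = norm (h1 - h0)\<close>)
qed

theorem theorem3p9:
  fixes F :: "real^'n \<Rightarrow> real^'n"
    and B :: "real^'m^'n"
    and C :: "(real^'n) set"
    and L :: real
    and y0 y1 h0 h1 :: "real^'n"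
  assumes "CARD('m) < CARD('n)"
    and "CARD('m) < CARD('n) - 1"
    and "L > 0" and "L-lipschitz_on UNIV F"
    and "rank B = CARD('m)"
    and "bounded C" and "convex C" and "interior C \<noteq> {}" and "C1_boundary C"
    and "measurable_selection F B C"
    and "y0 \<in> interior C" and "y1 \<in> interior C"
    and "h0 = orth_proj (H_space B) y0" and "h1 = orth_proj (H_space B) y1"
    and "h0 \<noteq> h1"
    and "segment_integral_defined h0 h1 (\<lambda>h. 1 / s_bar F B C h h0 h1)"
  shows "control_time F B C y0 y1 \<ge> segment_integral h0 h1 (\<lambda>h. 1 / s_bar F B C h h0 h1)"
  unfolding control_time_def
proof (rule Inf_greatest, clarify)
  fix T u y
  assume "T > 0" and sol: "control_solution F B T u y"
    and y: "y0 = y 0" "y1 = y T" and C: "\<forall>t\<in>{0..T}. y t \<in> C"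
  let ?g = "\<lambda>r. 1 / s_bar F B C (arc_length_point h0 h1 r) h0 h1"
  let ?M = "lebesgue_on {0..norm (h1 - h0)}"
  \<comment> \<open>The negative part of the integrand only lowers the left-hand side.\<close>
  have "segment_integral h0 h1 (\<lambda>h. 1 / s_bar F B C h h0 h1) \<le> enn2ereal (\<integral>\<^sup>+ r. e2ennreal (?g r) \<partial>?M)"
    unfolding segment_integral_def ext_integral_def by (rule ereal_diff_le_self) simp
  also have "\<dots> \<le> enn2ereal (ennreal T)"
  proof -
    have "(\<integral>\<^sup>+ r. e2ennreal (?g r) \<partial>?M) \<le> ennreal T"
      using nn_integral_inverse_s_bar_le_time[OF lipschitz_on_continuous_on[OF assms(4)] _ sol _ _ _ assms(15)]
        \<open>T > 0\<close> C assms(13,14) y by simp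
    then show ?thesis by (simp add: less_eq_ennreal.rep_eq)
  qed
  also have "\<dots> = ereal T" using \<open>T > 0\<close> by simp
  finally show "segment_integral h0 h1 (\<lambda>h. 1 / s_bar F B C h h0 h1) \<le> ereal T" .
qed

end
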